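(* There are infinitely many geometrically distinct symmetric figure eight periodic orbits of the planar symmetric Euler problem, such that their essential parts are embeddings.
   Context: Planar symmetric Euler problem: fix $M>0$, $\rho>0$ and let $e_1=(1,0)\in\mathbb R^2$. Two fixed centers of equal mass $M$ are located at $\pm\rho e_1$, with potential $U(\mathbf r)=-\frac{M}{\|\mathbf r+\rho e_1\|}-\frac{M}{\|\mathbf r-\rho e_1\|}$ on $\mathbb R^2\setminus\{\pm\rho e_1\}$. The problem is the differential equation $\ddot{\mathbf r}=-\nabla U(\mathbf r)$ for $\mathbf r=(x,y)\in\mathbb R^2\setminus\{\pm\rho e_1\}$. Essential part: an orbit (solution) $\mathbf r(t)=(x(t),y(t))$, $t\in[0,\tau]$, $\tau>0$, is an essential part of a symmetric figure eight orbit if (1) $y(0)=0$ and $x(0)>\rho$; (2) $\mathbf r(\tau)=(0,0)$; (3) $\dot x(0)=0$; (4) $y(t)>0$ for $t\in(0,\tau)$. Let $\varphi_1(x,y)=(-x,y)$ and $\varphi_2(x,y)=(x,-y)$. The corresponding symmetric figure eight periodic orbit is the $4\tau$-periodic orbit $\bar{\mathbf r}:\mathbb R\to\mathbb R^2$ given, for $n\in\mathbb Z$, by $\bar{\mathbf r}(t)=\mathbf r(t-4n\tau)$ on $[4n\tau,(4n+1)\tau]$; $\varphi_1\varphi_2\mathbf r((4n+2)\tau-t)$ on $[(4n+1)\tau,(4n+2)\tau]$; $\varphi_1\mathbf r(t-(4n+2)\tau)$ on $[(4n+2)\tau,(4n+3)\tau]$; $\varphi_2\mathbf r(4n\tau-t)$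 on $[(4n-1)\tau,4n\tau]$. The orbit $\mathbf r:[0,\tau]\to\mathbb R^2$ is called its essential part. Orbits are geometrically distinct if their traces (images) are different. *)

theory Defs
  imports "HOL-Analysis.Analysis"
begin

definition e1 :: "real \<times> real" where
  "e1 = (1, 0)"

text \<open>The values of this total function at the two centers are junk; it is only used off the centers.\<close>

definition potential :: "real \<Rightarrow> real \<Rightarrow> real \<times> real \<Rightarrow> real" where
  "potential M \<rho> p = - M / norm (p + \<rho> *\<^sub>R e1) - M / norm (p - \<rho> *\<^sub>R e1)"

text \<open>Derivatives are relative to the time interval \<open>T\<close>, hence one-sided at its end points;
  \<open>v\<close> is the velocity and \<open>g t\<close> the gradient of the potential at \<open>r t\<close>.\<close>

definition euler_orbit :: "real \<Rightarrow> real \<Rightarrow> real set \<Rightarrow> (real \<Rightarrow> real \<times> real) \<Rightarrow> bool" where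
  "euler_orbit M \<rho> T r \<longleftrightarrow>
     (\<forall>t\<in>T. r t \<notin> {\<rho> *\<^sub>R e1, - (\<rho> *\<^sub>R e1)}) \<and>
     (\<exists>v g. \<forall>t\<in>T.
        (r has_vector_derivative v t) (at t within T) \<and>
        (v has_vector_derivative - g t) (at t within T) \<and>
        (GDERIV (potential M \<rho>) (r t) :> g t))"

definition essential_part :: "real \<Rightarrow> real \<Rightarrow> real \<Rightarrow> (real \<Rightarrow> real \<times> real) \<Rightarrow> bool" where
  "essential_part M \<rho> \<tau> r \<longleftrightarrow>
     \<tau> > 0 \<and>
     euler_orbit M \<rho> {0..\<tau>} r \<and>
     snd (r 0) = 0 \<and> fst (r 0) > \<rho> \<and>
     r \<tau> = (0, 0) \<and>
     ((\<lambda>t. fst (r t)) has_real_derivative 0) (at 0 within {0..\<tau>}) \<and>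
     (\<forall>t\<in>{0<..<\<tau>}. snd (r t) > 0)"

definition \<phi>1 :: "real \<times> real \<Rightarrow> real \<times> real" where
  "\<phi>1 p = (- fst p, snd p)"

definition \<phi>2 :: "real \<times> real \<Rightarrow> real \<times> real" where
  "\<phi>2 p = (fst p, - snd p)"

text \<open>\<open>R\<close> is the symmetric figure eight periodic orbit with essential part \<open>r\<close> on \<open>[0, \<tau>]\<close>.
  The values of \<open>r\<close> outside \<open>[0, \<tau>]\<close> are irrelevant.\<close>

definition figure_eight_orbit ::
  "real \<Rightarrow> real \<Rightarrow> real \<Rightarrow> (real \<Rightarrow> real \<times> real) \<Rightarrow> (real \<Rightarrow> real \<times> real) \<Rightarrow> bool" where
  "figure_eight_orbit M \<rho> \<tau> r R \<longleftrightarrow>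
     essential_part M \<rho> \<tau> r \<and>
     euler_orbit M \<rho> UNIV R \<and>
     (\<forall>t. R (t + 4 * \<tau>) = R t) \<and>
     (\<forall>n::int.
        (\<forall>t\<in>{(4 * of_int n) * \<tau>..(4 * of_int n + 1) * \<tau>}.
           R t = r (t - 4 * of_int n * \<tau>)) \<and>
        (\<forall>t\<in>{(4 * of_int n + 1) * \<tau>..(4 * of_int n + 2) * \<tau>}.
           R t = \<phi>1 (\<phi>2 (r ((4 * of_int n + 2) * \<tau> - t)))) \<and>
        (\<forall>t\<in>{(4 * of_int n + 2) * \<tau>..(4 * of_int n + 3) * \<tau>}.
           R t = \<phi>1 (r (t - (4 * of_int n + 2) * \<tau>))) \<and>
        (\<forall>t\<in>{(4 * of_int n - 1) * \<tau>..4 * of_int n * \<tau>}.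
           R t = \<phi>2 (r (4 * of_int n * \<tau> - t))))"

text \<open>Embedding in the differentiable sense: a topological embedding that is an immersion.\<close>

definition embedded_arc :: "real \<Rightarrow> (real \<Rightarrow> real \<times> real) \<Rightarrow> bool" where
  "embedded_arc \<tau> r \<longleftrightarrow>
     embedding_map (top_of_set {0..\<tau>}) euclidean r \<and>
     (\<forall>t\<in>{0..\<tau>}. r differentiable (at t within {0..\<tau>}) \<and>
        vector_derivative r (at t within {0..\<tau>}) \<noteq> 0)"

definition geometrically_distinct ::
  "(real \<Rightarrow> real \<times> real) \<Rightarrow> (real \<Rightarrow> real \<times> real) \<Rightarrow> bool" where
  "geometrically_distinct R S \<longleftrightarrow> range R \<noteq> range S"

end

theory Submission
  imports Defs
begin

text \<open>
  In elliptic coordinates \<open>x = \<rho> cosh \<xi> cos \<eta>\<close>, \<open>y = \<rho> sinh \<xi> sin \<eta>\<close> and in the fictitious time \<open>s\<close>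
  with \<open>dt = \<kappa> (cosh\<^sup>2 \<xi> - cos\<^sup>2 \<eta>) ds\<close> the Euler problem separates. For bounded motions of the
  kind needed here, and after normalising \<open>s\<close>, the first integrals take the form
  \<open>\<xi>'\<^sup>2 = (a - cosh \<xi>) (cosh \<xi> - b)\<close>, \<open>\<eta>'\<^sup>2 = a b + cos\<^sup>2 \<eta>\<close>, with two parameters \<open>0 < b < 1 < a\<close>
  in place of the energy and the separation constant. Starting at the turning point
  \<open>cosh \<xi> = a\<close>, \<open>\<eta> = 0\<close>, the point leaves the axis perpendicularly at \<open>x = \<rho> a\<close>; it arrives at
  the origin, which is \<open>\<xi> = 0\<close>, \<open>\<eta> = \<pi>/2\<close>, if and only if both quarter periods agree. As \<open>\<xi>\<close>
  decreases and \<open>\<eta>\<close> increases on the way, \<open>x\<close> is strictly decreasing and the arc is embedded.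

  The substitution \<open>tanh (\<xi>/2) = A cos \<theta>\<close>, \<open>A\<^sup>2 = (a - 1)/(a + 1)\<close>, resolves the turning point and turns
  the radial equation into \<open>\<theta>'\<^sup>2 = \<alpha> + \<beta> cos\<^sup>2 \<theta>\<close>, which is of the same shape as the equation for
  \<open>\<eta>\<close>. Both angles, and later the physical time, are therefore inverses of antiderivatives of
  positive, even, periodic functions (\<open>even_periodic_clock\<close>). These exist on the whole line and
  carry the reflection and translation symmetries with them, so that the orbit is obtained
  for all times at once, already with the symmetries of a figure eight.

  For each \<open>a \<ge> 5\<close> the intermediate value theorem yields a \<open>b\<close> with equal quarter periods
  (\<open>equal_quarter_periods\<close>). The resulting trace has \<open>\<rho> a\<close> as its largest abscissa, so different
  \<open>a\<close> give different traces.
\<close>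

section \<open>Clocks\<close>

text \<open>The inverse \<open>G\<close> of the odd antiderivative \<open>F\<close> of \<open>f\<close> solves \<open>G' = 1 / f(G)\<close> globally.
  Evenness and periodicity of \<open>f\<close> give \<open>F (- x) = - F x\<close> and \<open>F (x + P) = F x + F P\<close>; together they
  force \<open>F P = 2 F (P/2)\<close>, which is why all symmetries of \<open>G\<close> are governed by the half period
  value \<open>H = F (P/2)\<close>.\<close>

lemma even_periodic_clock:
  fixes f :: "real \<Rightarrow> real" and P :: real
  assumes cont: "continuous_on UNIV f" and pos: "\<And>x. f x > 0"
    and even: "\<And>x. f (- x) = f x" and per: "\<And>x. f (x + P) = f x" and "P > 0"
  obtains G H where "H = integral {0..P/2} f" "H > 0"
    "\<And>y. (G has_real_derivative 1 / f (G y)) (at y)" "strict_mono G"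
    "G 0 = 0" "G H = P / 2" "\<And>y. G (- y) = - G y"
    "\<And>y k. G (y + 2 * of_int k * H) = G y + of_int k * P"
proof -
  have isc: "isCont f x" for x
    using cont by (simp add: continuous_on_eq_continuous_at)
  obtain F0 where F0: "\<And>x. (F0 has_vector_derivative f x) (at x)"
    using einterval_antiderivative[of "-\<infinity>" "\<infinity>" f] isc by auto
  define F where "F x = F0 x - F0 0" for x
  have F': "(F has_real_derivative f x) (at x)" for x
    unfolding F_def using F0[of x]
    by (auto intro!: derivative_eq_intros simp: has_real_derivative_iff_has_vector_derivative)
  have mono: "strict_mono F"
    by (metis F' pos DERIV_pos_imp_increasing strict_mono_def)
  have F0': "F 0 = 0" by (simp add: F_def)
  have odd: "F (- x) = - F x" for x
  proof -
    have "((\<lambda>x. F (- x) + F x) has_real_derivative 0) (at x)" for x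
      by (auto intro!: derivative_eq_intros DERIV_chain2[OF F'] F' simp: even)
    then have "F (- x) + F x = F (- 0) + F 0"
      by (intro DERIV_isconst_all) blast
    then show ?thesis by (simp add: F0')
  qed
  have shift: "F (x + P) = F x + F P" for x
  proof -
    have "((\<lambda>x. F (x + P) - F x) has_real_derivative 0) (at x)" for x
      by (auto intro!: derivative_eq_intros DERIV_chain2[OF F'] F' simp: per)
    then have "F (x + P) - F x = F (0 + P) - F 0"
      by (intro DERIV_isconst_all) blast
    then show ?thesis by (simp add: F0')
  qed
  define H where "H = F (P / 2)"
  have FP: "F P = 2 * H"
    using shift[of "- (P / 2)"] odd[of "P/2"] by (simp add: H_def)
  have Hpos: "H > 0"
    using mono \<open>P > 0\<close> F0' unfolding H_def strict_mono_def by (metis half_gt_zero)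
  have shift_int: "F (x + of_int k * P) = F x + 2 * of_int k * H" for x k
  proof (induction k arbitrary: x rule: int_induct[where k = 0])
    case base then show ?case by simp
  next
    case (step1 i)
    show ?case using shift[of "x + of_int i * P"] step1(2)[of x] FP by (simp add: algebra_simps)
  next
    case (step2 i)
    show ?case using shift[of "x + of_int (i - 1) * P"] step2(2)[of x] FP
      by (simp add: algebra_simps)
  qed
  have surj: "\<exists>x. F x = y" for y
  proof -
    obtain n :: nat where n: "\<bar>y\<bar> < of_nat n * H"
      using reals_Archimedean3[OF Hpos] by blast
    have "F (real n * P) = 2 * real n * H"
      using shift_int[of 0 "int n"] F0' by simp
    moreover have "2 * real n * H \<ge> real n * H" using Hpos by simp
    ultimately have "y \<le> F (real n * P)" "F (- (real n * P)) \<le> y"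
      using n odd[of "real n * P"] by linarith+
    moreover have "- (real n * P) \<le> real n * P" using \<open>P > 0\<close> by simp
    moreover have "continuous_on {- (real n * P)..real n * P} F"
      using F' by (meson DERIV_isCont continuous_at_imp_continuous_on)
    ultimately show ?thesis using IVT'[of F] by blast
  qed
  define G where "G = inv F"
  have inj: "inj F" using mono by (rule strict_mono_imp_inj_on)
  have GF: "G (F x) = x" for x using inj by (simp add: G_def)
  have FG: "F (G y) = y" for y unfolding G_def by (metis surj surj_def surj_f_inv_f)
  have contG: "isCont G y" for y
  proof -
    have "isCont G (F (G y))"
      by (rule isCont_inverse_function[where f = F and d = 1]) (auto simp: GF intro: DERIV_isCont F')
    then show ?thesis by (simp add: FG)
  qed
  show ?thesis
  proof
    have "(f has_integral F (P/2) - F 0) {0..P/2}"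
      using F' \<open>P > 0\<close> by (intro fundamental_theorem_of_calculus)
        (auto simp: has_real_derivative_iff_has_vector_derivative
          intro: has_vector_derivative_at_within)
    then show "H = integral {0..P/2} f" by (simp add: F0' H_def integral_unique)
    show "H > 0" by fact
    show "(G has_real_derivative 1 / f (G y)) (at y)" for y
      using DERIV_inverse_function[where f = F and g = G and a = "y - 1" and b = "y + 1"] F' pos[of "G y"] FG contG
      by (simp add: inverse_eq_divide)
    show "strict_mono G"
      by (metis FG mono strict_mono_less strict_mono_def)
    show "G 0 = 0" using GF[of 0] F0' by simp
    show "G H = P / 2" unfolding H_def by (rule GF)
    show "G (- y) = - G y" for y by (metis GF FG odd)
    show "G (y + 2 * of_int k * H) = G y + of_int k * P" for y k
      by (metis GF FG shift_int)
  qed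
qed

section \<open>Quarter periods\<close>

text \<open>The complete elliptic integral of the first kind \<open>K(k) / sqrt (p + q)\<close> with \<open>k\<^sup>2 = q / (p + q)\<close>.\<close>

definition quarter_period :: "real \<Rightarrow> real \<Rightarrow> real" where
  "quarter_period p q = integral {0..pi/2} (\<lambda>x. 1 / sqrt (p + q * (cos x)\<^sup>2))"

lemma radicand_pos: "p > 0 \<Longrightarrow> q \<ge> 0 \<Longrightarrow> p + q * (cos x)\<^sup>2 > (0::real)"
  by (simp add: add_pos_nonneg)

text \<open>The equation is \<open>\<phi>'\<^sup>2 = p + q cos\<^sup>2 \<phi>\<close>, a rotating pendulum in the angle \<open>2 \<phi>\<close>; the right-hand
  side never vanishes, so \<open>\<phi>\<close> is a clock of period \<open>\<pi>\<close>.\<close>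

lemma pendulum_motion:
  fixes p q :: real
  assumes "p > 0" "q \<ge> 0"
  obtains \<phi> where
    "\<And>s. (\<phi> has_real_derivative sqrt (p + q * (cos (\<phi> s))\<^sup>2)) (at s)"
    "strict_mono \<phi>" "\<phi> 0 = 0" "\<phi> (quarter_period p q) = pi / 2" "\<And>s. \<phi> (- s) = - \<phi> s"
    "\<And>s k. \<phi> (s + 2 * of_int k * quarter_period p q) = \<phi> s + of_int k * pi"
    "quarter_period p q > 0"
proof -
  let ?f = "\<lambda>x. 1 / sqrt (p + q * (cos x)\<^sup>2)"
  have pos: "p + q * (cos x)\<^sup>2 > 0" for x using assms by (rule radicand_pos)
  then have nz: "p + q * (cos x)\<^sup>2 \<noteq> 0" for x by (metis less_irrefl)
  have "continuous_on UNIV ?f" using nz by (intro continuous_intros) auto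
  then show ?thesis
  proof (rule even_periodic_clock[of ?f pi])
    show "1 / sqrt (p + q * (cos x)\<^sup>2) > 0" for x using pos by simp
    fix G H
    assume "H = integral {0..pi/2} ?f" "H > 0"
      "\<And>y. (G has_real_derivative 1 / ?f (G y)) (at y)" "strict_mono G"
      "G 0 = 0" "G H = pi / 2" "\<And>y. G (- y) = - G y"
      "\<And>y k. G (y + 2 * of_int k * H) = G y + of_int k * pi"
    then show ?thesis
      using that[of G] by (simp add: quarter_period_def)
  qed simp_all
qed

lemma integrable_quarter:
  "p > 0 \<Longrightarrow> q \<ge> 0 \<Longrightarrow> (\<lambda>x. 1 / sqrt (p + q * (cos x)\<^sup>2)) integrable_on {0..pi/2}"
proof -
  assume "p > 0" "q \<ge> 0"
  then have nz: "p + q * (cos x)\<^sup>2 \<noteq> 0" for x using radicand_pos[of p q x] by simp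
  show ?thesis
    by (intro integrable_continuous_real continuous_intros) (use nz in auto)
qed

lemma quarter_period_antimono:
  assumes "p > 0" "q \<ge> 0" "p \<le> p'" "q \<le> q'"
  shows "quarter_period p' q' \<le> quarter_period p q"
  unfolding quarter_period_def
proof (rule integral_le)
  show "1 / sqrt (p' + q' * (cos x)\<^sup>2) \<le> 1 / sqrt (p + q * (cos x)\<^sup>2)" for x
    using assms radicand_pos[of p q x]
    by (intro divide_left_mono real_sqrt_le_mono add_mono mult_right_mono mult_pos_pos)
      (auto simp: radicand_pos)
qed (use assms integrable_quarter in auto)

lemma quarter_period_upper:
  assumes "p > 0" "q \<ge> 0"
  shows "quarter_period p q \<le> (pi / 2) / sqrt p"
  using quarter_period_antimono[of p 0 p q] assms
  by (simp add: quarter_period_def)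

lemma inverse_sqrt_above_tangent:
  fixes x m :: real
  assumes "x > 0" "m > 0"
  shows "1 / sqrt m - (x - m) / (2 * m * sqrt m) \<le> 1 / sqrt x"
proof -
  define r s where "r = sqrt m" "s = sqrt x"
  have rs: "r > 0" "s > 0" "m = r\<^sup>2" "x = s\<^sup>2" using assms by (auto simp: r_s_def)
  have "1 / s - (1 / r - (s\<^sup>2 - r\<^sup>2) / (2 * r\<^sup>2 * r)) = (r - s)\<^sup>2 * (2 * r + s) / (2 * r^3 * s)"
    using rs(1,2) by (simp add: field_simps) algebra
  also have "\<dots> \<ge> 0" using rs(1,2) by simp
  finally show ?thesis using rs by simp
qed

text \<open>Jensen's inequality for the convex function \<open>1 / sqrt x\<close>: the mean of \<open>cos\<^sup>2\<close> over
  \<open>[0, \<pi>/2]\<close> is \<open>1/2\<close>.\<close>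

lemma quarter_period_lower:
  assumes "p > 0" "q \<ge> 0"
  shows "(pi / 2) / sqrt (p + q / 2) \<le> quarter_period p q"
proof -
  define m where "m = p + q / 2"
  have m: "m > 0" using assms by (simp add: m_def)
  \<comment> \<open>\<open>?g\<close> is the tangent of \<open>1 / sqrt x\<close> at the mean \<open>m\<close>, evaluated at \<open>p + q cos\<^sup>2 x\<close>.\<close>
  let ?g = "\<lambda>x. 1 / sqrt m - (q * cos (2 * x) / 2) / (2 * m * sqrt m)"
  let ?h = "\<lambda>x. x / sqrt m - (q * sin (2 * x) / 4) / (2 * m * sqrt m)"
  have "(?h has_real_derivative ?g x) (at x within {0..pi/2})" for x
    using m by (auto intro!: derivative_eq_intros simp: mult.commute sqrt_divide_self_eq inverse_eq_divide)
  then have "(?g has_integral ?h (pi/2) - ?h 0) {0..pi/2}"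
    by (intro fundamental_theorem_of_calculus)
      (auto simp flip: has_real_derivative_iff_has_vector_derivative)
  then have g: "(?g has_integral (pi/2) / sqrt m) {0..pi/2}" by simp
  have "?g x \<le> 1 / sqrt (p + q * (cos x)\<^sup>2)" for x
  proof -
    have tangent: "p + q * (cos x)\<^sup>2 - m = q * cos (2 * x) / 2"
      by (simp only: m_def cos_double_cos) (simp add: field_simps)
    show ?thesis
      using inverse_sqrt_above_tangent[OF radicand_pos[OF assms] m, of x] unfolding tangent .
  qed
  then show ?thesis
    using has_integral_le[OF g integrable_integral[OF integrable_quarter[OF assms]]]
    by (simp add: quarter_period_def m_def)
qed

lemma continuous_on_quarter_period:
  fixes B :: "real set"
  assumes "continuous_on B p" "continuous_on B q" "\<And>b. b \<in> B \<Longrightarrow> p b > 0" "\<And>b. b \<in> B \<Longrightarrow> q b \<ge> 0"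
  shows "continuous_on B (\<lambda>b. quarter_period (p b) (q b))"
proof -
  have nz: "p b + q b * (cos x)\<^sup>2 \<noteq> 0" if "b \<in> B" for b x
    using radicand_pos[OF assms(3,4)[OF that], of x] by simp
  have "continuous_on (B \<times> cbox 0 (pi/2)) (\<lambda>x. cos (snd x))"
    by (intro continuous_on_cos continuous_on_snd continuous_on_id)
  then have "continuous_on (B \<times> cbox 0 (pi/2)) (\<lambda>(b, x). 1 / sqrt (p b + q b * (cos x)\<^sup>2))"
    unfolding case_prod_unfold
    by (intro continuous_intros continuous_on_compose2[OF assms(1)] continuous_on_compose2[OF assms(2)])
      (use nz in auto)
  from integral_continuous_on_param[OF this] show ?thesis
    by (simp add: quarter_period_def)
qed

text \<open>The coefficients of the radial pendulum equation \<open>\<theta>'\<^sup>2 = \<alpha> + \<beta> cos\<^sup>2 \<theta>\<close>.\<close>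

definition alpha :: "real \<Rightarrow> real \<Rightarrow> real" where "alpha a b = (a + 1) * (1 - b) / 4"
definition beta :: "real \<Rightarrow> real \<Rightarrow> real" where "beta a b = (1 + b) * (a - 1) / 4"

text \<open>Small \<open>b\<close> makes the angular motion slow. At \<open>b = (a + 1) / (5 a + 1)\<close> the constant terms
  agree, \<open>\<alpha> = a b\<close>, while \<open>\<beta> \<ge> 1\<close> thanks to \<open>a \<ge> 5\<close>, so the radial motion is at least as fast. At
  \<open>b = 1/2\<close> the crude bounds \<open>\<pi> / (2 sqrt p)\<close> and \<open>\<pi> / (2 sqrt (p + q/2))\<close> already separate the two
  periods in the opposite order.\<close>

lemma equal_quarter_periods:
  assumes "a \<ge> 5"
  shows "\<exists>b. 0 < b \<and> b < 1 \<and> quarter_period (alpha a b) (beta a b) = quarter_period (a * b) 1"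
proof -
  define l where "l = (a + 1) / (5 * a + 1)"
  have l: "0 < l" "l \<le> 1/2" using assms by (auto simp: l_def field_simps)
  let ?f = "\<lambda>b. quarter_period (a * b) 1 - quarter_period (alpha a b) (beta a b)"
  have "continuous_on {l..1/2} ?f"
    unfolding alpha_def beta_def
    by (intro continuous_intros continuous_on_quarter_period) (use assms l in auto)
  moreover have "?f l \<ge> 0"
  proof -
    have "alpha a l = a * l" using assms unfolding alpha_def l_def by (simp add: field_simps)
    moreover have "(1 + l) * (a - 1) \<ge> 1 * 4" using l assms by (intro mult_mono) auto
    then have "beta a l \<ge> 1" by (simp add: beta_def)
    ultimately show ?thesis using quarter_period_antimono[of "a * l" 1 "a * l"] assms l by simp
  qed
  moreover have "?f (1/2) \<le> 0"
  proof -
    have "quarter_period (a * (1/2)) 1 \<le> (pi / 2) / sqrt (a * (1/2))"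
      using assms by (intro quarter_period_upper) auto
    also have "\<dots> \<le> (pi / 2) / sqrt (alpha a (1/2) + beta a (1/2) / 2)"
      using assms
      by (intro divide_left_mono real_sqrt_le_mono mult_pos_pos) (auto simp: alpha_def beta_def field_simps)
    also have "\<dots> \<le> quarter_period (alpha a (1/2)) (beta a (1/2))"
      using assms by (intro quarter_period_lower) (auto simp: alpha_def beta_def)
    finally show ?thesis by simp
  qed
  ultimately obtain b where "l \<le> b" "b \<le> 1/2" "?f b = 0"
    using IVT2'[of ?f "1/2" 0 l] l by blast
  then show ?thesis using l by (intro exI[of _ b]) auto
qed

section \<open>Elliptic coordinates\<close>

lemma gradient_potential:
  assumes "p \<noteq> \<rho> *\<^sub>R e1" "p \<noteq> - (\<rho> *\<^sub>R e1)"
  shows "GDERIV (potential M \<rho>) p :>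
    (M / norm (p + \<rho> *\<^sub>R e1) ^ 3) *\<^sub>R (p + \<rho> *\<^sub>R e1) + (M / norm (p - \<rho> *\<^sub>R e1) ^ 3) *\<^sub>R (p - \<rho> *\<^sub>R e1)"
proof -
  have *: "((\<lambda>p. - M / norm (p + k)) has_derivative
      (\<lambda>h. inner h ((M / norm (p + k) ^ 3) *\<^sub>R (p + k)))) (at p)"
    if "p + k \<noteq> 0" for k :: "real \<times> real"
  proof -
    have "((\<lambda>p. p + k) has_derivative (\<lambda>h. h)) (at p)"
      by (auto intro!: derivative_eq_intros)
    from has_derivative_compose[OF this has_derivative_norm[OF that]]
    have "((\<lambda>p. norm (p + k)) has_derivative (\<lambda>h. inner h (sgn (p + k)))) (at p)" .
    from has_derivative_divide[OF has_derivative_const[of "-M"] this] that show ?thesis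
      by (rule_tac has_derivative_eq_rhs)
        (auto simp: sgn_div_norm fun_eq_iff power3_eq_cube divide_simps)
  qed
  have "p + \<rho> *\<^sub>R e1 \<noteq> 0" "p + - (\<rho> *\<^sub>R e1) \<noteq> 0"
    using assms by (auto simp: add_eq_0_iff2)
  from has_derivative_add[OF this[THEN *]] show ?thesis
    unfolding gderiv_def potential_def inner_add_right by simp
qed

text \<open>The Newton equation in elliptic coordinates, as a polynomial identity. Here \<open>C\<close>, \<open>S\<close> are
  \<open>cosh \<xi>\<close>, \<open>sinh \<xi>\<close>, and \<open>c\<close>, \<open>s\<close> are \<open>cos \<eta>\<close>, \<open>sin \<eta>\<close>, with speeds \<open>u = \<xi>'\<close> and \<open>w = \<eta>'\<close>; \<open>N\<close> is
  the derivative of \<open>C c\<close> (below, of \<open>S s\<close>), so \<open>N / D\<close> is a velocity component up to a constant, and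
  \<open>Np D - N Dp\<close> is the numerator of its derivative. The distances from the centers are
  \<open>\<rho> (C \<plusminus> c)\<close>, which explains the cubes.\<close>

lemma separated_acceleration_fst:
  fixes C S c s u w up wp a b D N Dp Np :: real
  assumes "S * S = C * C - 1" "s * s = 1 - c * c"
    and "u * u = (a - C) * (C - b)" "w * w = a * b + c * c"
    and "up = S * (a + b - 2 * C) / 2" "wp = - c * s"
    and "D = C * C - c * c" "Dp = 2 * C * S * u + 2 * c * s * w"
    and "N = S * u * c - C * s * w"
    and "Np = C * c * (u * u - w * w) - 2 * S * s * u * w + S * c * up - C * s * wp"
  shows "Np * D - N * Dp = - (a + b) / 4 * ((C * c + 1) * (C - c) ^ 3 + (C * c - 1) * (C + c) ^ 3)"
  using assms by algebra

lemma separated_acceleration_snd: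
  fixes C S c s u w up wp a b D N Dp Np :: real
  assumes "S * S = C * C - 1" "s * s = 1 - c * c"
    and "u * u = (a - C) * (C - b)" "w * w = a * b + c * c"
    and "up = S * (a + b - 2 * C) / 2" "wp = - c * s"
    and "D = C * C - c * c" "Dp = 2 * C * S * u + 2 * c * s * w"
    and "N = C * u * s + S * c * w"
    and "Np = S * s * (u * u - w * w) + 2 * C * c * u * w + C * s * up + S * c * wp"
  shows "Np * D - N * Dp = - (a + b) / 4 * (S * s * (C - c) ^ 3 + S * s * (C + c) ^ 3)"
  using assms by algebra

text \<open>With \<open>m\<close>, \<open>n\<close> the two distances divided by \<open>\<rho>\<close>, the acceleration found by separation becomes
  the sum of the two Newtonian forces; this is what fixes the constant \<open>\<kappa>\<close> in the change of time.\<close>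

lemma sum_of_attractions:
  fixes m n \<rho> \<kappa> M e X Y :: real
  assumes "m > 0" "n > 0" "\<rho> > 0" "\<kappa> > 0" "4 * M * \<kappa>\<^sup>2 = \<rho> ^ 3 * e"
  shows "\<rho> / \<kappa> * ((- e / 4 * (X * m ^ 3 + Y * n ^ 3)) / ((m * n) * (m * n)) * (1 / (\<kappa> * (m * n)))) =
    - (M / (\<rho> * n) ^ 3 * (\<rho> * X) + M / (\<rho> * m) ^ 3 * (\<rho> * Y))"
proof -
  have e: "e = 4 * M * \<kappa>\<^sup>2 / \<rho> ^ 3" using assms by (simp add: field_simps)
  show ?thesis unfolding e using assms(1-4)
    by (simp add: divide_simps) (simp add: algebra_simps power2_eq_square power3_eq_cube)
qed

text \<open>The change of time is singular exactly at the collisions, where \<open>C\<^sup>2 = c\<^sup>2\<close>. Away from them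
  elliptic coordinates are conformal, so that \<open>w > 0\<close> alone makes the velocity nonzero.\<close>

lemma elliptic_orbit:
  fixes C S c s u w \<sigma> :: "real \<Rightarrow> real" and M \<rho> \<kappa> a b :: real
  assumes pos: "M > 0" "\<rho> > 0" "\<kappa> > 0" and \<kappa>: "4 * M * \<kappa>\<^sup>2 = \<rho> ^ 3 * (a + b)"
    and C': "\<And>x. (C has_real_derivative S x * u x) (at x)"
    and S': "\<And>x. (S has_real_derivative C x * u x) (at x)"
    and u': "\<And>x. (u has_real_derivative S x * (a + b - 2 * C x) / 2) (at x)"
    and c': "\<And>x. (c has_real_derivative - s x * w x) (at x)"
    and s': "\<And>x. (s has_real_derivative c x * w x) (at x)"
    and w': "\<And>x. (w has_real_derivative - c x * s x) (at x)"
    and S2: "\<And>x. S x * S x = C x * C x - 1" and s2: "\<And>x. s x * s x = 1 - c x * c x"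
    and u2: "\<And>x. u x * u x = (a - C x) * (C x - b)"
    and w2: "\<And>x. w x * w x = a * b + c x * c x"
    and w0: "\<And>x. w x > 0" and C1: "\<And>x. C x \<ge> 1" and D0: "\<And>x. C x * C x - c x * c x > 0"
    and \<sigma>': "\<And>t. (\<sigma> has_real_derivative
                1 / (\<kappa> * (C (\<sigma> t) * C (\<sigma> t) - c (\<sigma> t) * c (\<sigma> t)))) (at t)"
  defines "R \<equiv> \<lambda>t. (\<rho> * (C (\<sigma> t) * c (\<sigma> t)), \<rho> * (S (\<sigma> t) * s (\<sigma> t)))"
  shows "euler_orbit M \<rho> UNIV R" and "\<exists>v. (R has_vector_derivative v) (at t) \<and> v \<noteq> 0"
proof -
  define D where "D x = C x * C x - c x * c x" for x
  define Dp where "Dp x = 2 * C x * S x * u x + 2 * c x * s x * w x" for x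
  define N1 where "N1 x = S x * u x * c x - C x * s x * w x" for x
  define N2 where "N2 x = C x * u x * s x + S x * c x * w x" for x
  define Np1 where "Np1 x = C x * c x * (u x * u x - w x * w x) - 2 * S x * s x * u x * w x
    + S x * c x * (S x * (a + b - 2 * C x) / 2) - C x * s x * (- c x * s x)" for x
  define Np2 where "Np2 x = S x * s x * (u x * u x - w x * w x) + 2 * C x * c x * u x * w x
    + C x * s x * (S x * (a + b - 2 * C x) / 2) + S x * c x * (- c x * s x)" for x
  note ders = C'[THEN DERIV_cong] S'[THEN DERIV_cong] u'[THEN DERIV_cong]
    c'[THEN DERIV_cong] s'[THEN DERIV_cong] w'[THEN DERIV_cong]
  have Dpos: "D x > 0" for x using D0 by (simp add: D_def)
  have Dfac: "D x = (C x - c x) * (C x + c x)" for x by (simp add: D_def algebra_simps)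
  have far: "C x - c x > 0" "C x + c x > 0" for x
    using Dpos[of x] C1[of x] unfolding Dfac zero_less_mult_iff by linarith+
  have D': "(D has_real_derivative Dp x) (at x)" for x
    unfolding D_def[abs_def] by (rule derivative_eq_intros ders refl)+ (simp add: Dp_def)
  have X': "((\<lambda>x. C x * c x) has_real_derivative N1 x) (at x)"
    and Y': "((\<lambda>x. S x * s x) has_real_derivative N2 x) (at x)" for x
    by (rule derivative_eq_intros ders refl | simp add: N1_def N2_def algebra_simps)+
  have N1': "(N1 has_real_derivative Np1 x) (at x)" for x
    unfolding N1_def[abs_def]
    by (rule derivative_eq_intros ders refl)+ (simp add: Np1_def algebra_simps)
  have N2': "(N2 has_real_derivative Np2 x) (at x)" for x
    unfolding N2_def[abs_def]
    by (rule derivative_eq_intros ders refl)+ (simp add: Np2_def algebra_simps)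
  have VX': "((\<lambda>x. N1 x / D x) has_real_derivative (Np1 x * D x - N1 x * Dp x) / (D x * D x)) (at x)"
    and VY': "((\<lambda>x. N2 x / D x) has_real_derivative (Np2 x * D x - N2 x * Dp x) / (D x * D x)) (at x)"
    for x using Dpos[of x] by (auto intro!: DERIV_divide N1' N2' D')
  have \<sigma>'D: "(\<sigma> has_real_derivative 1 / (\<kappa> * D (\<sigma> t))) (at t)" for t
    using \<sigma>' by (simp add: D_def)
  note vec = has_real_derivative_iff_has_vector_derivative
  define v where "v t = (\<rho> / \<kappa> * (N1 (\<sigma> t) / D (\<sigma> t)), \<rho> / \<kappa> * (N2 (\<sigma> t) / D (\<sigma> t)))" for t
  define A where "A t = (\<rho> / \<kappa> * ((Np1 (\<sigma> t) * D (\<sigma> t) - N1 (\<sigma> t) * Dp (\<sigma> t)) / (D (\<sigma> t) * D (\<sigma> t))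
        * (1 / (\<kappa> * D (\<sigma> t)))),
      \<rho> / \<kappa> * ((Np2 (\<sigma> t) * D (\<sigma> t) - N2 (\<sigma> t) * Dp (\<sigma> t)) / (D (\<sigma> t) * D (\<sigma> t))
        * (1 / (\<kappa> * D (\<sigma> t)))))" for t
  have R': "(R has_vector_derivative v t) (at t)" for t
    unfolding R_def v_def
    by (rule has_vector_derivative_Pair; unfold vec[symmetric];
        rule DERIV_cmult[THEN DERIV_cong, OF DERIV_chain2[OF X' \<sigma>'D]]
          DERIV_cmult[THEN DERIV_cong, OF DERIV_chain2[OF Y' \<sigma>'D]]; simp)
  have v': "(v has_vector_derivative A t) (at t)" for t
    unfolding v_def[abs_def] A_def
    by (rule has_vector_derivative_Pair; unfold vec[symmetric];
        rule DERIV_cmult DERIV_chain2[OF VX' \<sigma>'D] DERIV_chain2[OF VY' \<sigma>'D])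
      (rule DERIV_chain2[OF VX' \<sigma>'D] DERIV_chain2[OF VY' \<sigma>'D])+
  define g where "g t = (M / norm (R t + \<rho> *\<^sub>R e1) ^ 3) *\<^sub>R (R t + \<rho> *\<^sub>R e1)
    + (M / norm (R t - \<rho> *\<^sub>R e1) ^ 3) *\<^sub>R (R t - \<rho> *\<^sub>R e1)" for t
  have dist: "norm (R t + \<rho> *\<^sub>R e1) = \<rho> * (C (\<sigma> t) + c (\<sigma> t))"
    "norm (R t - \<rho> *\<^sub>R e1) = \<rho> * (C (\<sigma> t) - c (\<sigma> t))" for t
  proof -
    have "norm (R t + (k * \<rho>) *\<^sub>R e1) = \<rho> * (C (\<sigma> t) + k * c (\<sigma> t))"
      if "k * k = 1" "C (\<sigma> t) + k * c (\<sigma> t) > 0" for k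
    proof -
      have "(\<rho> * (C (\<sigma> t) * c (\<sigma> t)) + k * \<rho>)\<^sup>2 + (\<rho> * (S (\<sigma> t) * s (\<sigma> t)))\<^sup>2
          = (\<rho> * (C (\<sigma> t) + k * c (\<sigma> t)))\<^sup>2"
        using S2[of "\<sigma> t"] s2[of "\<sigma> t"] that(1) by algebra
      then show ?thesis using that(2) pos by (simp add: R_def e1_def norm_Pair)
    qed
    from this[of 1] this[of "-1"] show "norm (R t + \<rho> *\<^sub>R e1) = \<rho> * (C (\<sigma> t) + c (\<sigma> t))"
      "norm (R t - \<rho> *\<^sub>R e1) = \<rho> * (C (\<sigma> t) - c (\<sigma> t))"
      using far[of "\<sigma> t"] by auto
  qed
  have noncoll: "R t \<noteq> \<rho> *\<^sub>R e1" "R t \<noteq> - (\<rho> *\<^sub>R e1)" for t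
    using dist[of t] far[of "\<sigma> t"] pos by auto
  have "A t = - g t" for t
  proof (rule prod_eqI)
    let ?x = "\<sigma> t"
    let ?force = "\<lambda>X Y. M / (\<rho> * (C ?x + c ?x)) ^ 3 * (\<rho> * X) + M / (\<rho> * (C ?x - c ?x)) ^ 3 * (\<rho> * Y)"
    have D1: "D ?x = C ?x * C ?x - c ?x * c ?x" by (simp add: D_def)
    have "fst (g t) = ?force (C ?x * c ?x + 1) (C ?x * c ?x - 1)"
      "snd (g t) = ?force (S ?x * s ?x) (S ?x * s ?x)"
      unfolding g_def dist by (simp_all add: R_def e1_def ring_distribs)
    note g = this
    show "fst (A t) = fst (- g t)"
      unfolding A_def fst_conv fst_uminus g
      unfolding separated_acceleration_fst[OF S2 s2 u2 w2 refl refl D1 Dp_def N1_def Np1_def]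
      unfolding Dfac
      by (rule sum_of_attractions[OF far[of ?x] pos(2,3) \<kappa>])
    show "snd (A t) = snd (- g t)"
      unfolding A_def snd_conv snd_uminus g
      unfolding separated_acceleration_snd[OF S2 s2 u2 w2 refl refl D1 Dp_def N2_def Np2_def]
      unfolding Dfac
      by (rule sum_of_attractions[OF far[of ?x] pos(2,3) \<kappa>])
  qed
  then show "euler_orbit M \<rho> UNIV R"
    unfolding euler_orbit_def using noncoll R' v' gradient_potential[OF noncoll]
    by (intro conjI exI[of _ v] exI[of _ g]) (auto simp: g_def)
  \<comment> \<open>conformality: the squared speed is the conformal factor times \<open>\<xi>'\<^sup>2 + \<eta>'\<^sup>2\<close>\<close>
  have "N1 x * N1 x + N2 x * N2 x = D x * (u x * u x + w x * w x)" for x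
    unfolding N1_def N2_def D_def using S2[of x] s2[of x] by algebra
  then have "N1 x * N1 x + N2 x * N2 x > 0" for x
    using Dpos[of x] w0[of x] by (simp add: add_nonneg_pos)
  then have "v t \<noteq> 0"
    using pos Dpos[of "\<sigma> t"] by (auto simp: v_def zero_prod_def) (metis add_0 less_irrefl mult_zero_left)
  with R' show "\<exists>v. (R has_vector_derivative v) (at t) \<and> v \<noteq> 0" by blast
qed

section \<open>Angular and radial motion\<close>

lemma pendulum_speed_deriv:
  assumes "p > 0" "q \<ge> 0"
    and \<phi>': "(\<phi> has_real_derivative sqrt (p + q * (cos (\<phi> s))\<^sup>2)) (at s)"
  shows "((\<lambda>s. sqrt (p + q * (cos (\<phi> s))\<^sup>2)) has_real_derivative
    - q * cos (\<phi> s) * sin (\<phi> s)) (at s)"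
proof -
  have pos: "p + q * (cos (\<phi> s))\<^sup>2 > 0" using assms by (intro radicand_pos)
  have "((\<lambda>s. p + q * (cos (\<phi> s))\<^sup>2) has_real_derivative
      - 2 * q * cos (\<phi> s) * sin (\<phi> s) * sqrt (p + q * (cos (\<phi> s))\<^sup>2)) (at s)"
    by (rule derivative_eq_intros \<phi>' refl | simp)+
  from DERIV_chain2[OF DERIV_real_sqrt[OF pos] this] show ?thesis
    by (rule DERIV_cong) (use pos in simp)
qed

text \<open>Only \<open>cos \<eta>\<close>, \<open>sin \<eta>\<close> and the speed \<open>\<eta>'\<close> enter the orbit. The zeros of \<open>cos \<eta>\<close> at the odd multiples
  of \<open>T\<close> are what later excludes collisions.\<close>

lemma angular_motion:
  fixes e :: real
  assumes "e > 0"
  defines "T \<equiv> quarter_period e 1"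
  obtains c s w :: "real \<Rightarrow> real" where
    "\<And>x. (c has_real_derivative - s x * w x) (at x)"
    "\<And>x. (s has_real_derivative c x * w x) (at x)"
    "\<And>x. (w has_real_derivative - c x * s x) (at x)"
    "\<And>x. s x * s x = 1 - c x * c x" "\<And>x. w x * w x = e + c x * c x" "\<And>x. w x > 0"
    "\<And>x. c (- x) = c x" "\<And>x. s (- x) = - s x"
    "\<And>x. c (x + 2 * T) = - c x" "\<And>x. s (x + 2 * T) = - s x"
    "c 0 = 1" "s 0 = 0" "\<And>k. c (T + 2 * of_int k * T) = 0"
    "\<And>x. 0 < x \<Longrightarrow> x < T \<Longrightarrow> s x > 0"
    "\<And>x y. 0 \<le> x \<Longrightarrow> x < y \<Longrightarrow> y \<le> T \<Longrightarrow> c y < c x"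
proof (rule pendulum_motion[of e 1])
  fix \<eta> assume \<eta>: "\<And>s. (\<eta> has_real_derivative sqrt (e + 1 * (cos (\<eta> s))\<^sup>2)) (at s)"
    "strict_mono \<eta>" "\<eta> 0 = 0" "\<eta> (quarter_period e 1) = pi / 2" "\<And>s. \<eta> (- s) = - \<eta> s"
    "\<And>s k. \<eta> (s + 2 * of_int k * quarter_period e 1) = \<eta> s + of_int k * pi"
    "quarter_period e 1 > 0"
  have range: "0 \<le> \<eta> x" "\<eta> x \<le> pi / 2" if "0 \<le> x" "x \<le> T" for x
    using strict_mono_less_eq[OF \<eta>(2), of 0 x] strict_mono_less_eq[OF \<eta>(2), of x T] \<eta>(3,4) that
    by (auto simp: T_def)
  have per: "\<eta> (x + 2 * T) = \<eta> x + pi" for x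
    using \<eta>(6)[of x 1] by (simp add: T_def)
  have pos: "e + (cos (\<eta> x))\<^sup>2 > 0" for x using radicand_pos[of e 1] assms by simp
  show ?thesis
  proof (rule that[of "\<lambda>x. cos (\<eta> x)" "\<lambda>x. sin (\<eta> x)" "\<lambda>x. sqrt (e + 1 * (cos (\<eta> x))\<^sup>2)"])
    fix x :: real
    show "((\<lambda>x. cos (\<eta> x)) has_real_derivative - sin (\<eta> x) * sqrt (e + 1 * (cos (\<eta> x))\<^sup>2)) (at x)"
      "((\<lambda>x. sin (\<eta> x)) has_real_derivative cos (\<eta> x) * sqrt (e + 1 * (cos (\<eta> x))\<^sup>2)) (at x)"
      by (rule derivative_eq_intros \<eta>(1) refl | simp)+
    show "((\<lambda>x. sqrt (e + 1 * (cos (\<eta> x))\<^sup>2)) has_real_derivative - cos (\<eta> x) * sin (\<eta> x)) (at x)"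
      using pendulum_speed_deriv[OF assms(1) _ \<eta>(1), of x] by simp
    show "sin (\<eta> x) * sin (\<eta> x) = 1 - cos (\<eta> x) * cos (\<eta> x)"
      using sin_squared_eq[of "\<eta> x"] by (simp add: power2_eq_square)
    show "sqrt (e + 1 * (cos (\<eta> x))\<^sup>2) * sqrt (e + 1 * (cos (\<eta> x))\<^sup>2) = e + cos (\<eta> x) * cos (\<eta> x)"
      "sqrt (e + 1 * (cos (\<eta> x))\<^sup>2) > 0"
      using pos[of x] by (simp_all add: power2_eq_square)
    show "sin (\<eta> x) > 0" if "0 < x" "x < T"
    proof (rule sin_gt_zero)
      show "\<eta> x > 0" using strict_mono_less[OF \<eta>(2), of 0 x] \<eta>(3) that by simp
      show "\<eta> x < pi" using range[of x] that pi_gt_zero by linarith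
    qed
    show "cos (\<eta> y) < cos (\<eta> x)" if "0 \<le> x" "x < y" "y \<le> T" for y
    proof (rule cos_monotone_0_pi)
      show "\<eta> x < \<eta> y" using \<eta>(2) that by (simp add: strict_mono_def)
      show "0 \<le> \<eta> x" using range[of x] that by simp
      show "\<eta> y \<le> pi" using range[of y] that pi_gt_zero by linarith
    qed
  next
    fix k :: int
    have "\<eta> (T + 2 * of_int k * T) = pi / 2 + of_int k * pi"
      using \<eta>(4,6) by (simp add: T_def)
    then show "cos (\<eta> (T + 2 * of_int k * T)) = 0"
      by (simp add: cos_add mult.commute[of _ pi])
  qed (simp_all add: \<eta>(3,5) per)
qed (use assms in simp_all)

text \<open>Here \<open>C\<close>, \<open>S\<close>, \<open>u\<close> are \<open>cosh \<xi>\<close>, \<open>sinh \<xi>\<close>, \<open>\<xi>'\<close>, written as rational functions of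
  \<open>z = tanh (\<xi>/2) = A cos \<theta>\<close> and its derivative \<open>y\<close>. In this form they are visibly smooth at the turning
  points, where \<open>\<xi>'\<close> is a square root that changes its sign.\<close>

lemma radial_motion:
  fixes a b :: real
  assumes a: "a > 1" and b: "0 < b" "b < 1"
  defines "T \<equiv> quarter_period (alpha a b) (beta a b)"
  obtains C S u :: "real \<Rightarrow> real" where
    "\<And>x. (C has_real_derivative S x * u x) (at x)"
    "\<And>x. (S has_real_derivative C x * u x) (at x)"
    "\<And>x. (u has_real_derivative S x * (a + b - 2 * C x) / 2) (at x)"
    "\<And>x. S x * S x = C x * C x - 1" "\<And>x. u x * u x = (a - C x) * (C x - b)"
    "\<And>x. C x \<ge> 1" "\<And>x. C x \<le> a"
    "\<And>x. C (- x) = C x" "\<And>x. S (- x) = S x"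
    "\<And>x. C (x + 2 * T) = C x" "\<And>x. S (x + 2 * T) = - S x"
    "C 0 = a" "S T = 0" "\<And>x. S x = 0 \<Longrightarrow> \<exists>k. x = T + 2 * of_int k * T"
    "\<And>x. 0 \<le> x \<Longrightarrow> x < T \<Longrightarrow> S x > 0"
    "\<And>x y. 0 \<le> x \<Longrightarrow> x \<le> y \<Longrightarrow> y \<le> T \<Longrightarrow> C y \<le> C x"
proof (rule pendulum_motion[of "alpha a b" "beta a b"])
  show al: "alpha a b > 0" and be: "beta a b \<ge> 0" using a b by (simp_all add: alpha_def beta_def)
  let ?W = "\<lambda>\<theta>. sqrt (alpha a b + beta a b * (cos \<theta>)\<^sup>2)"
  fix \<theta> assume \<theta>: "\<And>s. (\<theta> has_real_derivative ?W (\<theta> s)) (at s)"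
    "strict_mono \<theta>" "\<theta> 0 = 0" "\<theta> (quarter_period (alpha a b) (beta a b)) = pi / 2"
    "\<And>s. \<theta> (- s) = - \<theta> s"
    "\<And>s k. \<theta> (s + 2 * of_int k * quarter_period (alpha a b) (beta a b)) = \<theta> s + of_int k * pi"
    "quarter_period (alpha a b) (beta a b) > 0"
  have per: "\<theta> (x + 2 * T) = \<theta> x + pi" for x
    using \<theta>(6)[of x 1] by (simp add: T_def)
  have range: "0 \<le> \<theta> x" "\<theta> x \<le> pi / 2" if "0 \<le> x" "x \<le> T" for x
    using strict_mono_less_eq[OF \<theta>(2), of 0 x] strict_mono_less_eq[OF \<theta>(2), of x T] \<theta>(3,4) that
    by (auto simp: T_def)
  define A where "A = sqrt ((a - 1) / (a + 1))"
  have A: "A > 0" "A * A * (a + 1) = a - 1" using a by (simp_all add: A_def)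
  define z where "z x = A * cos (\<theta> x)" for x
  define y where "y x = - A * sin (\<theta> x) * ?W (\<theta> x)" for x
  define y' where "y' x = - z x * ((1 - a * b) + (1 + b) * (a + 1) * (z x * z x)) / 2" for x
  have W2: "?W t * ?W t = alpha a b + beta a b * (cos t)\<^sup>2" for t
    using radicand_pos[OF al be, of t] by simp
  have z': "(z has_real_derivative y x) (at x)" for x
    unfolding z_def[abs_def] y_def by (rule derivative_eq_intros \<theta>(1) refl | simp)+
  \<comment> \<open>the energy equation \<open>\<xi>'\<^sup>2 = (a - C) (C - b)\<close>, expressed through \<open>z\<close> and \<open>y = z'\<close>\<close>
  have y2: "4 * (y x * y x) = ((a - 1) - (a + 1) * (z x * z x)) * ((1 - b) + (1 + b) * (z x * z x))" for x
  proof -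
    have "4 * (y x * y x) = A * A * (sin (\<theta> x) * sin (\<theta> x)) * (4 * (?W (\<theta> x) * ?W (\<theta> x)))"
      by (simp add: y_def)
    then show ?thesis
      unfolding W2 unfolding z_def alpha_def beta_def
      using A(2) sin_squared_eq[of "\<theta> x"] by algebra
  qed
  have y': "(y has_real_derivative y' x) (at x)" for x
  proof -
    have "(y has_real_derivative - A * cos (\<theta> x) * (?W (\<theta> x) * ?W (\<theta> x))
        + A * sin (\<theta> x) * (beta a b * cos (\<theta> x) * sin (\<theta> x))) (at x)"
      unfolding y_def[abs_def]
      by (rule derivative_eq_intros pendulum_speed_deriv[OF al be] \<theta>(1) refl | simp)+
    moreover have "- A * cos (\<theta> x) * (?W (\<theta> x) * ?W (\<theta> x))
        + A * sin (\<theta> x) * (beta a b * cos (\<theta> x) * sin (\<theta> x)) = y' x"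
      unfolding W2 unfolding y'_def z_def alpha_def beta_def
      using A(2) sin_squared_eq[of "\<theta> x"] by algebra
    ultimately show ?thesis by simp
  qed
  have zA: "z x * z x \<le> A * A" for x
  proof -
    have "z x * z x = A * A * (cos (\<theta> x))\<^sup>2" by (simp add: z_def power2_eq_square)
    also have "\<dots> \<le> A * A * 1"
      by (intro mult_left_mono) (simp_all add: abs_square_le_1)
    finally show ?thesis by simp
  qed
  have "A * A = 1 - 2 / (a + 1)" using A(2) a by (simp add: field_simps)
  moreover have "2 / (a + 1) > 0" using a by simp
  ultimately have A1: "A * A < 1" by linarith
  define q where "q x = 1 - z x * z x" for x
  have q: "q x > 0" for x using zA[of x] A1 by (simp add: q_def)
  have q': "(q has_real_derivative - 2 * z x * y x) (at x)" for x
    unfolding q_def[abs_def] by (rule derivative_eq_intros z' refl | simp)+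
  define C where "C x = 2 / q x - 1" for x
  define S where "S x = 2 * z x / q x" for x
  define u where "u x = 2 * y x / q x" for x
  have zz: "z x * z x = 1 - q x" for x by (simp add: q_def)
  show ?thesis
  proof (rule that[of C S u])
    fix x :: real
    note qx = q[of x] less_imp_neq[OF q[of x], symmetric]
    show "(C has_real_derivative S x * u x) (at x)"
      unfolding C_def[abs_def] S_def u_def
      by (rule derivative_eq_intros q' refl | use qx in \<open>simp add: field_simps\<close>)+
    have S_num: "2 * y x * q x + 4 * z x * z x * y x = 2 * y x * (2 - q x)"
      using zz[of x] by algebra
    have "(S has_real_derivative (2 * y x * q x + 4 * z x * z x * y x) / (q x * q x)) (at x)"
      unfolding S_def[abs_def]
      by (rule derivative_eq_intros q' z' refl | use qx in \<open>simp add: field_simps\<close>)+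
    then show "(S has_real_derivative C x * u x) (at x)"
      unfolding S_num by (rule DERIV_cong) (use qx in \<open>simp add: C_def u_def field_simps\<close>)
    have u_num: "2 * y' x * q x + 4 * z x * (y x * y x) = z x * ((a + b + 2) * q x - 4)"
      unfolding y'_def using y2[of x] q_def[of x] by algebra
    have "(u has_real_derivative (2 * y' x * q x + 4 * z x * (y x * y x)) / (q x * q x)) (at x)"
      unfolding u_def[abs_def]
      by (rule derivative_eq_intros q' y' refl | use qx in \<open>simp add: field_simps\<close>)+
    then show "(u has_real_derivative S x * (a + b - 2 * C x) / 2) (at x)"
      unfolding u_num by (rule DERIV_cong) (use qx in \<open>simp add: C_def S_def field_simps\<close>)
    have "(2 * z x) * (2 * z x) = (2 - q x) * (2 - q x) - q x * q x" using zz[of x] by algebra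
    then show "S x * S x = C x * C x - 1"
      unfolding S_def C_def times_divide_times_eq using qx by (simp add: field_simps)
    have "(2 * y x) * (2 * y x) = (a * q x - (2 - q x)) * ((2 - q x) - b * q x)"
      using y2[of x] zz[of x] by algebra
    then show "u x * u x = (a - C x) * (C x - b)"
      unfolding u_def C_def times_divide_times_eq using qx by (simp add: field_simps)
    have "q x \<le> 1" by (simp add: q_def)
    then show "C x \<ge> 1" using qx by (simp add: C_def field_simps)
    have "(a + 1) * (z x * z x) \<le> (a + 1) * (A * A)"
      using zA[of x] a by (intro mult_left_mono) auto
    then have "2 \<le> (a + 1) * q x" using A(2) by (simp add: q_def algebra_simps)
    then show "C x \<le> a" using qx by (simp add: C_def field_simps)
    show "C (- x) = C x" "S (- x) = S x" "C (x + 2 * T) = C x" "S (x + 2 * T) = - S x"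
      by (simp_all add: C_def S_def q_def z_def \<theta>(5) per)
    show "\<exists>k. x = T + 2 * of_int k * T" if "S x = 0"
    proof -
      have "cos (\<theta> x) = 0" using that qx A by (simp add: S_def z_def)
      then obtain i where "odd i" "\<theta> x = of_int i * (pi / 2)" by (auto simp: cos_zero_iff_int)
      then obtain k where "i = 2 * k + 1" by (auto elim: oddE)
      with \<open>\<theta> x = _\<close> have "\<theta> x = pi / 2 + of_int k * pi" by (simp add: algebra_simps)
      also have "\<dots> = \<theta> (T + 2 * of_int k * T)" using \<theta>(4,6) by (simp add: T_def)
      finally show ?thesis using strict_mono_eq[OF \<theta>(2)] by blast
    qed
    show "S x > 0" if "0 \<le> x" "x < T"
    proof -
      have "\<theta> x < \<theta> T" using strict_mono_less[OF \<theta>(2)] that by simp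
      then have "\<theta> x < pi / 2" using \<theta>(4) by (simp add: T_def)
      then have "cos (\<theta> x) > 0" using range[of x] that by (intro cos_gt_zero_pi) auto
      then show ?thesis using qx A by (simp add: S_def z_def)
    qed
    show "C v \<le> C x" if "0 \<le> x" "x \<le> v" "v \<le> T" for v
    proof -
      have "\<theta> x \<le> \<theta> v" using strict_mono_less_eq[OF \<theta>(2)] that by simp
      then have "cos (\<theta> v) \<le> cos (\<theta> x)" "0 \<le> cos (\<theta> v)"
        using range[of x] range[of v] that pi_gt_zero
        by (intro cos_monotone_0_pi_le cos_ge_zero; linarith)+
      then have "z v * z v \<le> z x * z x" using A unfolding z_def by (intro mult_mono) auto
      then have "q x \<le> q v" by (simp add: q_def)
      then show ?thesis using q by (simp add: C_def frac_le)
    qed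
  next
    have "a * (1 - A * A) = 1 + A * A" using A(2) by algebra
    then show "C 0 = a" using A1 by (simp add: C_def q_def z_def \<theta>(3) field_simps)
    have "cos (\<theta> T) = cos (pi / 2)" using \<theta>(4) by (simp only: T_def)
    then show "S T = 0" by (simp add: S_def z_def)
  qed
qed

section \<open>Figure eight orbits\<close>

lemma periodic_int_multiple:
  fixes f :: "real \<Rightarrow> 'a"
  assumes "\<And>t. f (t + P) = f t"
  shows "f (t + of_int k * P) = f t"
proof (induction k arbitrary: t rule: int_induct[where k = 0])
  case base then show ?case by simp
next
  case (step1 i)
  show ?case using assms[of "t + of_int i * P"] step1(2)[of t] by (simp add: algebra_simps)
next
  case (step2 i)
  show ?case using assms[of "t + of_int (i - 1) * P"] step2(2)[of t] by (simp add: algebra_simps)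
qed

lemma euler_orbit_restrict:
  assumes "euler_orbit M \<rho> UNIV R"
  shows "euler_orbit M \<rho> X R"
proof -
  obtain v g where "\<forall>t. (R has_vector_derivative v t) (at t) \<and>
      (v has_vector_derivative - g t) (at t) \<and> (GDERIV (potential M \<rho>) (R t) :> g t)"
    using assms unfolding euler_orbit_def by auto
  then show ?thesis
    using assms unfolding euler_orbit_def
    by (intro conjI exI[of _ v] exI[of _ g]) (auto intro: has_vector_derivative_at_within)
qed

text \<open>The two symmetries of a global orbit already contain all four gluing rules: the translation by
  \<open>2 \<tau>\<close> applied twice is the period, and the pieces run backwards come from the time reversal.\<close>

lemma figure_eight_of_symmetric_orbit:
  assumes ess: "essential_part M \<rho> \<tau> R" and orbit: "euler_orbit M \<rho> UNIV R"
    and refl: "\<And>t. R (- t) = \<phi>2 (R t)" and shift: "\<And>t. R (t + 2 * \<tau>) = \<phi>1 (R t)"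
  shows "figure_eight_orbit M \<rho> \<tau> R R"
proof -
  have per: "R (t + 4 * \<tau>) = R t" for t
    using shift[of t] shift[of "t + 2 * \<tau>"] by (simp add: \<phi>1_def add.assoc)
  have whole: "R (t - 4 * of_int n * \<tau>) = R t" for t and n :: int
    using periodic_int_multiple[of R "4 * \<tau>", OF per, of t "- n"] by (simp add: mult_ac)
  have half: "\<phi>1 (R (t - (4 * of_int n + 2) * \<tau>)) = R t" for t and n :: int
    using shift[of "t - (4 * of_int n + 2) * \<tau>"] whole[of t n] by (simp add: algebra_simps)
  have "\<phi>1 (\<phi>2 (R ((4 * of_int n + 2) * \<tau> - t))) = R t"
    "\<phi>2 (R (4 * of_int n * \<tau> - t)) = R t" for t and n :: int
    using refl[of "(4 * of_int n + 2) * \<tau> - t"] half[of t n]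
      refl[of "4 * of_int n * \<tau> - t"] whole[of t n] by simp_all
  with ess orbit per whole half show ?thesis
    unfolding figure_eight_orbit_def by auto
qed

text \<open>The last two properties say that \<open>\<rho> a\<close> is the largest abscissa of the trace, by which the
  traces for different \<open>a\<close> are told apart.\<close>

lemma figure_eight_orbit_exists:
  fixes M \<rho> a :: real
  assumes "M > 0" "\<rho> > 0" "a \<ge> 5"
  shows "\<exists>\<tau> R. figure_eight_orbit M \<rho> \<tau> R R \<and> embedded_arc \<tau> R \<and>
    R 0 = (\<rho> * a, 0) \<and> (\<forall>t. fst (R t) \<le> \<rho> * a)"
proof -
  obtain b where b: "0 < b" "b < 1"
    \<comment> \<open>equal quarter periods synchronise \<open>\<xi> = 0\<close> with \<open>\<eta> = \<pi>/2\<close>\<close>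
    and eq: "quarter_period (alpha a b) (beta a b) = quarter_period (a * b) 1"
    using equal_quarter_periods[OF \<open>a \<ge> 5\<close>] by blast
  have ab: "a * b > 0" "a > 1" using b assms by auto
  define T where "T = quarter_period (a * b) 1"
  have "T > 0" unfolding T_def by (rule pendulum_motion[of "a * b" 1]) (use ab in auto)
  obtain c s w :: "real \<Rightarrow> real" where
    c': "\<And>x. (c has_real_derivative - s x * w x) (at x)" and
    s': "\<And>x. (s has_real_derivative c x * w x) (at x)" and
    w': "\<And>x. (w has_real_derivative - c x * s x) (at x)" and
    s2: "\<And>x. s x * s x = 1 - c x * c x" and w2: "\<And>x. w x * w x = a * b + c x * c x" and
    w0: "\<And>x. w x > 0" and
    cs_even_odd: "\<And>x. c (- x) = c x" "\<And>x. s (- x) = - s x" and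
    cs_shift: "\<And>x. c (x + 2 * T) = - c x" "\<And>x. s (x + 2 * T) = - s x" and
    cs0: "c 0 = 1" "s 0 = 0" and cT: "\<And>k. c (T + 2 * of_int k * T) = 0" and
    s_pos: "\<And>x. 0 < x \<Longrightarrow> x < T \<Longrightarrow> s x > 0" and
    c_dec: "\<And>x y. 0 \<le> x \<Longrightarrow> x < y \<Longrightarrow> y \<le> T \<Longrightarrow> c y < c x"
    by (rule angular_motion[OF ab(1), folded T_def]) (rule that; assumption)
  obtain C S u :: "real \<Rightarrow> real" where
    C': "\<And>x. (C has_real_derivative S x * u x) (at x)" and
    S': "\<And>x. (S has_real_derivative C x * u x) (at x)" and
    u': "\<And>x. (u has_real_derivative S x * (a + b - 2 * C x) / 2) (at x)" and
    S2: "\<And>x. S x * S x = C x * C x - 1" and u2: "\<And>x. u x * u x = (a - C x) * (C x - b)" and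
    C1: "\<And>x. C x \<ge> 1" and Ca: "\<And>x. C x \<le> a" and
    CS_even: "\<And>x. C (- x) = C x" "\<And>x. S (- x) = S x" and
    CS_shift: "\<And>x. C (x + 2 * T) = C x" "\<And>x. S (x + 2 * T) = - S x" and
    C0: "C 0 = a" and ST: "S T = 0" and
    S_zero: "\<And>x. S x = 0 \<Longrightarrow> \<exists>k. x = T + 2 * of_int k * T" and
    S_pos: "\<And>x. 0 \<le> x \<Longrightarrow> x < T \<Longrightarrow> S x > 0" and
    C_dec: "\<And>x y. 0 \<le> x \<Longrightarrow> x \<le> y \<Longrightarrow> y \<le> T \<Longrightarrow> C y \<le> C x"
    by (rule radial_motion[OF ab(2) b, unfolded eq, folded T_def]) (rule that; assumption)
  define D where "D x = C x * C x - c x * c x" for x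
  have c1: "c x * c x \<le> 1" for x using s2[of x] zero_le_square[of "s x"] by linarith
  \<comment> \<open>No collisions: \<open>C\<^sup>2 = c\<^sup>2\<close> would need \<open>C = 1\<close> and \<open>\<bar>c\<bar> = 1\<close>, but \<open>c\<close> vanishes whenever \<open>S\<close> does.\<close>
  have D0: "D x > 0" for x
  proof (cases "S x = 0")
    case True
    then have "c x = 0" using S_zero cT by blast
    then show ?thesis using C1[of x] by (simp add: D_def)
  next
    case False
    then have "S x * S x > 0" by (metis not_real_square_gt_zero)
    then show ?thesis using S2[of x] c1[of x] by (simp add: D_def)
  qed
  define \<kappa> where "\<kappa> = sqrt (\<rho> ^ 3 * (a + b) / (4 * M))"
  have \<kappa>: "\<kappa> > 0" "4 * M * \<kappa>\<^sup>2 = \<rho> ^ 3 * (a + b)"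
    using assms b by (simp_all add: \<kappa>_def)
  have "continuous_on UNIV (\<lambda>x. \<kappa> * D x)"
    unfolding D_def
    by (intro continuous_intros continuous_at_imp_continuous_on ballI DERIV_isCont[OF C'] DERIV_isCont[OF c'])
  then obtain \<sigma> \<tau> where "\<tau> > 0"
    and \<sigma>': "\<And>t. (\<sigma> has_real_derivative 1 / (\<kappa> * D (\<sigma> t))) (at t)"
    and \<sigma>_mono: "strict_mono \<sigma>" and \<sigma>0: "\<sigma> 0 = 0" and \<sigma>\<tau>: "\<sigma> \<tau> = T"
    and \<sigma>_odd: "\<And>t. \<sigma> (- t) = - \<sigma> t" and \<sigma>_shift: "\<And>t. \<sigma> (t + 2 * \<tau>) = \<sigma> t + 2 * T"
  proof (rule even_periodic_clock[of "\<lambda>x. \<kappa> * D x" "2 * T"])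
    fix G H
    assume *: "H > 0" "\<And>y. (G has_real_derivative 1 / (\<kappa> * D (G y))) (at y)" "strict_mono G"
      "G 0 = 0" "G H = 2 * T / 2" "\<And>y. G (- y) = - G y"
      "\<And>y k. G (y + 2 * of_int k * H) = G y + of_int k * (2 * T)"
    show ?thesis using *(7)[of _ 1] by (intro that[of H G]) (use * in simp_all)
  qed (use D0 \<kappa> \<open>T > 0\<close> in \<open>simp_all add: D_def CS_even CS_shift cs_even_odd cs_shift\<close>)
  define R where "R t = (\<rho> * (C (\<sigma> t) * c (\<sigma> t)), \<rho> * (S (\<sigma> t) * s (\<sigma> t)))" for t
  note R = elliptic_orbit[OF assms(1,2) \<kappa> C' S' u' c' s' w' S2 s2 u2 w2 w0 C1
      D0[unfolded D_def] \<sigma>'[unfolded D_def], folded R_def]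
  have refl: "R (- t) = \<phi>2 (R t)" and shift: "R (t + 2 * \<tau>) = \<phi>1 (R t)" for t
    by (simp_all add: R_def \<phi>1_def \<phi>2_def \<sigma>_odd \<sigma>_shift CS_even CS_shift cs_even_odd cs_shift)
  have R': "R differentiable at t within X" for t X
    using R(2)[of t] by (meson differentiableI_vector has_vector_derivative_at_within)
  have x_dec: "fst (R t') < fst (R t)" if "0 \<le> t" "t < t'" "t' \<le> \<tau>" for t t'
  proof -
    have *: "0 \<le> \<sigma> t" "\<sigma> t < \<sigma> t'" "\<sigma> t' \<le> T"
      using that strict_mono_less_eq[OF \<sigma>_mono, of 0 t] strict_mono_less[OF \<sigma>_mono, of t t']
        strict_mono_less_eq[OF \<sigma>_mono, of t' \<tau>] \<sigma>0 \<sigma>\<tau> by simp_all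
    have "0 \<le> c (\<sigma> t')"
      using c_dec[of "\<sigma> t'" T] cT[of 0] * by (cases "\<sigma> t' = T") auto
    then have "C (\<sigma> t') * c (\<sigma> t') \<le> C (\<sigma> t) * c (\<sigma> t')"
      using C_dec[of "\<sigma> t" "\<sigma> t'"] * by (intro mult_right_mono) auto
    also have "\<dots> < C (\<sigma> t) * c (\<sigma> t)"
      using c_dec[OF *] C1[of "\<sigma> t"] by (intro mult_strict_left_mono) auto
    finally show ?thesis using assms by (simp add: R_def)
  qed
  have "embedded_arc \<tau> R"
    unfolding embedded_arc_def
  proof (intro conjI ballI R')
    have "inj_on R {0..\<tau>}"
    proof (rule inj_onI, rule ccontr)
      fix t t' assume *: "t \<in> {0..\<tau>}" "t' \<in> {0..\<tau>}" "R t = R t'" "t \<noteq> t'"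
      then consider "t < t'" | "t' < t" by linarith
      then show False by cases (use * x_dec[of t t'] x_dec[of t' t] in auto)
    qed
    moreover have "continuous_on {0..\<tau>} R"
      using R' by (simp add: differentiable_imp_continuous_on differentiable_on_def)
    ultimately show "embedding_map (top_of_set {0..\<tau>}) euclidean R"
      by (intro continuous_imp_embedding_map) (auto simp: compact_space_subtopology)
    fix t assume t: "t \<in> {0..\<tau>}"
    obtain v where v: "(R has_vector_derivative v) (at t)" "v \<noteq> 0" using R(2) by blast
    have "vector_derivative R (at t within {0..\<tau>}) = v"
      using \<open>\<tau> > 0\<close> t has_vector_derivative_at_within[OF v(1)]
      by (rule vector_derivative_within_closed_interval)
    then show "vector_derivative R (at t within {0..\<tau>}) \<noteq> 0" using v(2) by simp
  qed
  moreover have "essential_part M \<rho> \<tau> R"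
    unfolding essential_part_def
  proof (intro conjI ballI)
    show "euler_orbit M \<rho> {0..\<tau>} R"
      by (rule euler_orbit_restrict[OF R(1)])
    show "snd (R 0) = 0" "fst (R 0) > \<rho>" "R \<tau> = (0, 0)"
      using assms cT[of 0] by (simp_all add: R_def \<sigma>0 \<sigma>\<tau> C0 cs0 ST)
    have "((\<lambda>x. C x * c x) has_real_derivative S 0 * u 0 * c 0 + - s 0 * w 0 * C 0) (at 0)"
      by (intro DERIV_mult C' c')
    moreover have "u 0 = 0" using u2[of 0] C0 by simp
    ultimately have "((\<lambda>x. C x * c x) has_real_derivative 0) (at (\<sigma> 0))"
      by (simp add: cs0 \<sigma>0)
    from DERIV_cmult[OF DERIV_chain2[OF this \<sigma>'], of \<rho>]
    show "((\<lambda>t. fst (R t)) has_real_derivative 0) (at 0 within {0..\<tau>})"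
      by (simp add: R_def has_field_derivative_at_within)
    fix t assume "t \<in> {0<..<\<tau>}"
    then have "0 < \<sigma> t" "\<sigma> t < T" 
      using strict_mono_less[OF \<sigma>_mono, of 0 t] strict_mono_less[OF \<sigma>_mono, of t \<tau>] \<sigma>0 \<sigma>\<tau> by simp_all
    then show "snd (R t) > 0" using s_pos S_pos assms by (simp add: R_def)
  qed fact
  moreover have "R 0 = (\<rho> * a, 0)" by (simp add: R_def \<sigma>0 C0 cs0)
  moreover have "fst (R t) \<le> \<rho> * a" for t
  proof -
    have "\<bar>c (\<sigma> t)\<bar> \<le> 1"
      using c1[of "\<sigma> t"] by (simp add: power2_eq_square flip: abs_square_le_1)
    then have "C (\<sigma> t) * c (\<sigma> t) \<le> C (\<sigma> t) * 1"
      using C1[of "\<sigma> t"] by (intro mult_left_mono) auto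
    also have "\<dots> \<le> a" using Ca by simp
    finally show ?thesis using assms by (simp add: R_def)
  qed
  ultimately show ?thesis
    using figure_eight_of_symmetric_orbit[OF _ R(1) refl shift] by blast
qed

theorem mainTheorem3:
  fixes M \<rho> :: real
  assumes "M > 0" and "\<rho> > 0"
  shows "\<exists>F. infinite F \<and>
    (\<forall>R\<in>F. \<exists>\<tau> r. figure_eight_orbit M \<rho> \<tau> r R \<and> embedded_arc \<tau> r) \<and>
    pairwise geometrically_distinct F"
proof -
  obtain R where R: "\<And>a. a \<ge> 5 \<Longrightarrow> \<exists>\<tau>. figure_eight_orbit M \<rho> \<tau> (R a) (R a) \<and> embedded_arc \<tau> (R a)"
    "\<And>a. a \<ge> 5 \<Longrightarrow> R a 0 = (\<rho> * a, 0)" "\<And>a t. a \<ge> 5 \<Longrightarrow> fst (R a t) \<le> \<rho> * a"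
    using figure_eight_orbit_exists[OF assms] by metis
  have traces: "a \<le> a'" if "a \<ge> 5" "a' \<ge> 5" "range (R a) = range (R a')" for a a'
  proof -
    have "(\<rho> * a, 0) \<in> range (R a')" using R(2)[OF that(1)] that(3) by (metis rangeI)
    then obtain t where "R a' t = (\<rho> * a, 0)" by auto
    then have "\<rho> * a \<le> \<rho> * a'" using R(3)[OF that(2), of t] by simp
    then show ?thesis using assms by simp
  qed
  then have distinct: "range (R a) \<noteq> range (R a')" if "a \<ge> 5" "a' \<ge> 5" "a \<noteq> a'" for a a'
    using that by (metis antisym)
  then have "inj_on R {5..}" by (intro inj_onI) (metis atLeast_iff)
  then have "infinite (R ` {5..})" by (simp add: finite_image_iff infinite_Ici)
  moreover have "pairwise geometrically_distinct (R ` {5..})"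
    unfolding pairwise_def geometrically_distinct_def using distinct by blast
  ultimately show ?thesis using R(1) by (intro exI[of _ "R ` {5..}"]) fastforce
qed

end
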